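(* Let $d\ge 1$. For all $f_1,f_2\in\mathcal F$ and all $V>0$, the cubic lattice $V^{1/d}\mathbb Z^d$ (with its standard basis $V^{1/d}e_1,\dots,V^{1/d}e_d$) is a critical point in $\mathcal L(V)$ of the alternating-charge energy $$E^{\pm}_{f_1,f_2}[L]=\sum_{p\in L\setminus\{0\}} f_1(|p|^2)+\sum_{p\in L\setminus\{0\}}\varphi_\pm(p)\,f_2(|p|^2).$$
   Context: A lattice in $\mathbb R^d$ is a set $L=\bigoplus_{i=1}^d\mathbb Z u_i$ for a basis $\{u_1,\dots,u_d\}$ of $\mathbb R^d$; its volume is $|\det(u_1,\dots,u_d)|$. $\mathcal L(V)$ is the set of lattices of volume $V$. The alternate charge distribution $\varphi_\pm$ on $L=\bigoplus_i\mathbb Z u_i$ is defined, for $p=\sum_{i=1}^d m_iu_i$ with $m_i\in\mathbb Z$, by $\varphi_\pm(p)=+1$ if $\sum_i m_i$ is even and $\varphi_\pm(p)=-1$ otherwise. It depends on the chosen basis. Thus $E^\pm_{f_1,f_2}$ is regarded as a function of the basis $(u_1,\dots,u_d)$ subject to $|\det(u_1,\dots,u_d)|=V$, and "critical point in $\mathcal L(V)$" means that the differential of this function, restricted to the hypersurface $\{|\det(u_1,\dots,u_d)|=V\}$ of $(\mathbb R^d)^d$, vanishes at $u_i=V^{1/d}e_i$. Potentials: $\mathcal S$ is the set of functions $f:(0,\infty)\to\mathbb R$ such that $f(r)=\int_0^\infty e^{-rt}\,d\mu_f(t)$ for all $r>0$, for some nonnegative Borel measure $\mu_f$ on $(0,\infty)$,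 and $f(r)=O(r^{-s})$ as $r\to+\infty$ for some $s>d/2$. $\mathcal F$ is the class of functions that are Laplace transforms of a (signed) Borel measure on $(0,\infty)$ with the same decay, understood as the set of functions that can be written as the difference of two functions in $\mathcal S$. *)

theory Defs
  imports "HOL-Analysis.Analysis" "HOL-Library.Landau_Symbols"
begin

section \<open>Lattices, charges and energy as functions of a basis\<close>

text \<open>A tuple \<open>(u\<^sub>1, \<dots>, u\<^sub>d)\<close> of vectors in \<open>\<real>\<^sup>d\<close>, with \<open>d = CARD('n)\<close>, is the
  matrix \<open>u :: real^'n^'n\<close> with rows \<open>u $ i\<close>; its rows form a basis iff \<open>det u \<noteq> 0\<close>.\<close>

definition lattice_point :: "real^'n^'n \<Rightarrow> ('n \<Rightarrow> int) \<Rightarrow> real^'n" where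
  "lattice_point u m = (\<Sum>i\<in>UNIV. of_int (m i) *\<^sub>R (u $ i))"

definition lattice_of :: "real^'n^'n \<Rightarrow> (real^'n) set" where
  "lattice_of u = range (lattice_point u)"

text \<open>For a basis \<open>u\<close> the integer coordinates of a lattice point are unique, so the existential
  quantifier speaks about the coordinates of \<open>p\<close>.\<close>

definition alt_charge :: "real^'n^'n \<Rightarrow> real^'n \<Rightarrow> real" where
  "alt_charge u p =
     (if \<exists>m. p = lattice_point u m \<and> even (\<Sum>i\<in>UNIV. m i) then 1 else - 1)"

definition alt_energy :: "(real \<Rightarrow> real) \<Rightarrow> (real \<Rightarrow> real) \<Rightarrow> real^'n^'n \<Rightarrow> real" where
  "alt_energy f1 f2 u =
     (\<Sum>\<^sub>\<infinity>p\<in>lattice_of u - {0}. f1 ((norm p)\<^sup>2)) +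
     (\<Sum>\<^sub>\<infinity>p\<in>lattice_of u - {0}. alt_charge u p * f2 ((norm p)\<^sup>2))"

definition bases_of_volume :: "real \<Rightarrow> (real^'n^'n) set" where
  "bases_of_volume V = {u. \<bar>det u\<bar> = V}"

definition cubic_basis :: "real \<Rightarrow> real^'n^'n" where
  "cubic_basis V = (\<chi> i. (V powr (1 / real CARD('n))) *\<^sub>R axis i 1)"


section \<open>Classes of potentials\<close>

text \<open>Potentials are functions on \<open>(0,\<infinity>)\<close>; their values at arguments \<open>r \<le> 0\<close> are
  unconstrained and never used.\<close>

definition potentials_S :: "nat \<Rightarrow> (real \<Rightarrow> real) set" where
  "potentials_S d = {f.
     (\<exists>\<mu> :: real measure. sets \<mu> = sets (restrict_space borel {0<..}) \<and>
        (\<forall>r>0. has_bochner_integral \<mu> (\<lambda>t. exp (- (r * t))) (f r))) \<and>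
     (\<exists>s > real d / 2. f \<in> O[at_top](\<lambda>r. r powr (- s)))}"

definition potentials_F :: "nat \<Rightarrow> (real \<Rightarrow> real) set" where
  "potentials_F d =
     {f. \<exists>g\<in>potentials_S d. \<exists>h\<in>potentials_S d. \<forall>r>0. f r = g r - h r}"


section \<open>Critical points of functions restricted to a hypersurface\<close>

definition tangent_vectors :: "'a::real_normed_vector set \<Rightarrow> 'a \<Rightarrow> 'a set" where
  "tangent_vectors S x = {v. \<exists>\<gamma> :: real \<Rightarrow> 'a. \<gamma> 0 = x \<and>
     eventually (\<lambda>t. \<gamma> t \<in> S) (nhds 0) \<and> (\<gamma> has_vector_derivative v) (at 0)}"

text \<open>A derivative within \<open>S\<close> need not be unique as a linear map on the ambient space, but its
  values on tangent vectors are; these values are the differential of the restriction of \<open>F\<close>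
  to \<open>S\<close>.\<close>

definition critical_point_on ::
    "'a::real_normed_vector set \<Rightarrow> ('a \<Rightarrow> real) \<Rightarrow> 'a \<Rightarrow> bool" where
  "critical_point_on S F x \<longleftrightarrow> x \<in> S \<and>
     (\<exists>D. (F has_derivative D) (at x within S) \<and> (\<forall>v\<in>tangent_vectors S x. D v = 0))"

end

theory Submission
  imports Defs
begin

text \<open>Written in integer coordinates, the energy near the cubic basis is a sum over \<open>m \<noteq> 0\<close> of
  \<open>w m * f (norm (lattice_point u m) ^ 2)\<close>, where \<open>w\<close> is \<open>1\<close> or the parity sign of \<open>m\<close>. A Laplace
  transform \<open>f\<close> of a nonnegative measure is decreasing and satisfies
  \<open>\<bar>f' r\<bar> \<le> 2 / r * f (r / 2)\<close>, so that the derivatives of the summands at the cubic basis are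
  dominated by a multiple of \<open>norm m powr (- (2 * s))\<close> with \<open>2 * s > d\<close> and the sum may be
  differentiated termwise. The derivative in direction \<open>v\<close> is
  \<open>\<Sum>i j. v i j * (\<Sum>m. c m * m i * m j)\<close> with \<open>c\<close> invariant under sign changes and permutations of
  the coordinates; hence the inner sum vanishes for \<open>i \<noteq> j\<close> and does not depend on \<open>i\<close> for \<open>i = j\<close>,
  and the differential is a multiple of the trace. So is the differential of the determinant at
  the cubic basis, which vanishes on the tangent vectors.\<close>

section \<open>Differentiation under integrals and infinite sums\<close>

text \<open>Along the line \<open>x + t *\<^sub>R h\<close> the difference quotients are bounded by
  \<open>B * norm h\<close>, and the bound passes to the limit. Thus Lipschitz control of increments
  from \<open>x\<close> also controls the derivative.\<close>

lemma has_derivative_norm_le: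
  fixes f :: "'a::real_normed_vector \<Rightarrow> real"
  assumes f: "(f has_derivative f') (at x)"
    and U: "open U" "x \<in> U"
    and lip: "\<And>u. u \<in> U \<Longrightarrow> \<bar>f u - f x\<bar> \<le> B * norm (u - x)"
  shows "\<bar>f' h\<bar> \<le> B * norm h"
proof -
  have lin: "linear f'"
    using f has_derivative_linear by blast
  have "((\<lambda>t. x + t *\<^sub>R h) has_derivative (\<lambda>t. t *\<^sub>R h)) (at (0::real))"
    by (auto intro!: derivative_eq_intros)
  then have "((\<lambda>t. f (x + t *\<^sub>R h)) has_derivative (\<lambda>t. f' (t *\<^sub>R h))) (at (0::real))"
    by (rule has_derivative_compose) (use f in simp)
  then have "((\<lambda>t. f (x + t *\<^sub>R h)) has_field_derivative f' h) (at (0::real))"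
    by (rule has_derivative_imp_has_field_derivative) (simp add: linear_scale[OF lin])
  then have lim: "((\<lambda>t. \<bar>(f (x + t *\<^sub>R h) - f x) / t\<bar>) \<longlongrightarrow> \<bar>f' h\<bar>) (at 0)"
    unfolding has_field_derivative_iff by (intro tendsto_rabs) simp
  have "((\<lambda>t::real. x + t *\<^sub>R h) \<longlongrightarrow> x + 0 *\<^sub>R h) (at 0)"
    by (intro tendsto_intros)
  then have "\<forall>\<^sub>F t::real in at 0. x + t *\<^sub>R h \<in> U"
    using U by (simp add: tendsto_def)
  then have "\<forall>\<^sub>F t::real in at 0. \<bar>(f (x + t *\<^sub>R h) - f x) / t\<bar> \<le> B * norm h"
    using eventually_neq_at_within[of "0::real"]
  proof eventually_elim
    case (elim t)
    then show ?case
      using lip[of "x + t *\<^sub>R h"] by (simp add: abs_divide pos_divide_le_eq mult_ac)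
  qed
  with lim show ?thesis
    by (rule tendsto_upperbound) simp
qed

text \<open>Dominated convergence, along an arbitrary sequence tending to \<open>x\<close>, for the
  normalised remainder of the integrand. Domination is imposed on increments from \<open>x\<close>;
  \<open>has_derivative_norm_le\<close> turns it into a bound on \<open>G\<close>.\<close>

lemma has_derivative_integral_dominated:
  fixes g :: "'a::real_normed_vector \<Rightarrow> 'b \<Rightarrow> real"
  assumes U: "open U" "x \<in> U"
    and int: "\<And>u. u \<in> U \<Longrightarrow> integrable M (g u)"
    and der: "\<And>w. w \<in> space M \<Longrightarrow> ((\<lambda>u. g u w) has_derivative G w) (at x)"
    and meas: "\<And>h. (\<lambda>w. G w h) \<in> borel_measurable M"
    and B: "integrable M B"
    and lip: "\<And>u w. u \<in> U \<Longrightarrow> w \<in> space M \<Longrightarrow> \<bar>g u w - g x w\<bar> \<le> B w * norm (u - x)"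
  shows "((\<lambda>u. \<integral>w. g u w \<partial>M) has_derivative (\<lambda>h. \<integral>w. G w h \<partial>M)) (at x)"
proof -
  have lin: "linear (G w)" if "w \<in> space M" for w
    using der[OF that] has_derivative_linear by blast
  have bd: "\<bar>G w h\<bar> \<le> B w * norm h" if "w \<in> space M" for w h
    by (rule has_derivative_norm_le[OF der[OF that] U]) (use lip that in auto)
  have intG: "integrable M (\<lambda>w. G w h)" for h
    by (rule Bochner_Integration.integrable_bound[where f = "\<lambda>w. B w * norm h"])
       (use B bd meas in \<open>auto intro!: AE_I2 intro: order_trans[OF _ abs_ge_self]\<close>)
  have "bounded_linear (\<lambda>h. \<integral>w. G w h \<partial>M)"
  proof (rule bounded_linear_intro[where K = "\<integral>w. B w \<partial>M"])
    fix h k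
    have "(\<integral>w. G w (h + k) \<partial>M) = (\<integral>w. G w h + G w k \<partial>M)"
      by (intro Bochner_Integration.integral_cong) (auto simp: linear_add[OF lin])
    then show "(\<integral>w. G w (h + k) \<partial>M) = (\<integral>w. G w h \<partial>M) + (\<integral>w. G w k \<partial>M)"
      using intG by simp
  next
    fix r :: real and h
    have "(\<integral>w. G w (r *\<^sub>R h) \<partial>M) = (\<integral>w. r * G w h \<partial>M)"
      by (intro Bochner_Integration.integral_cong) (auto simp: linear_scale[OF lin])
    then show "(\<integral>w. G w (r *\<^sub>R h) \<partial>M) = r *\<^sub>R (\<integral>w. G w h \<partial>M)"
      by simp
  next
    fix h
    have "norm (\<integral>w. G w h \<partial>M) \<le> (\<integral>w. norm (G w h) \<partial>M)"
      by (rule integral_norm_bound)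
    also have "\<dots> \<le> (\<integral>w. B w * norm h \<partial>M)"
      by (rule integral_mono) (use intG B bd in auto)
    finally have "norm (\<integral>w. G w h \<partial>M) \<le> (\<integral>w. B w * norm h \<partial>M)" .
    then show "norm (\<integral>w. G w h \<partial>M) \<le> norm h * (\<integral>w. B w \<partial>M)"
      by (simp add: mult.commute)
  qed
  moreover have "((\<lambda>u. norm ((\<integral>w. g u w \<partial>M) - (\<integral>w. g x w \<partial>M) - (\<integral>w. G w (u - x) \<partial>M)) / norm (u - x))
      \<longlongrightarrow> 0) (at x)"
    unfolding tendsto_at_iff_sequentially
  proof (intro allI impI)
    fix X :: "nat \<Rightarrow> 'a"
    assume X: "\<forall>i. X i \<in> UNIV - {x}" "X \<longlonglongrightarrow> x"
    \<comment> \<open>Integrability and the Lipschitz bound hold on \<open>U\<close>, so finitely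
      many initial terms are cut off; the limit does not change.\<close>
    obtain N where N: "\<And>k. X (k + N) \<in> U"
    proof -
      have "\<forall>\<^sub>F k in sequentially. X k \<in> U"
        using X(2) U by (simp add: tendsto_def)
      then show ?thesis
        using that unfolding eventually_sequentially by (meson le_add2)
    qed
    define Y where "Y = (\<lambda>k. X (k + N))"
    have Y: "Y k \<in> U" "norm (Y k - x) > 0" for k
      using N X(1) by (auto simp: Y_def)
    have Yx: "Y \<longlonglongrightarrow> x"
      unfolding Y_def by (rule LIMSEQ_ignore_initial_segment[OF X(2)])
    define q where "q = (\<lambda>k w. (g (Y k) w - g x w - G w (Y k - x)) / norm (Y k - x))"
    have "(\<lambda>k. \<integral>w. q k w \<partial>M) \<longlonglongrightarrow> (\<integral>w. 0 \<partial>M)"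
    \<comment> \<open>The factor 2 counts \<open>B\<close> once for the increment of
      \<open>g\<close> and once for the linear term \<open>G\<close>.\<close>
    proof (rule integral_dominated_convergence[where w = "\<lambda>w. 2 * B w"])
      show "q k \<in> borel_measurable M" for k
        using int[OF Y(1)[of k]] int[OF U(2)] meas unfolding q_def
        by (intro borel_measurable_divide borel_measurable_diff) auto
      show "AE w in M. (\<lambda>k. q k w) \<longlonglongrightarrow> 0"
      proof (rule AE_I2)
        fix w assume "w \<in> space M"
        from der[OF this] have "((\<lambda>u. norm (g u w - g x w - G w (u - x)) / norm (u - x)) \<longlongrightarrow> 0) (at x)"
          by (simp add: has_derivative_iff_norm)
        then have "(\<lambda>k. norm (q k w)) \<longlonglongrightarrow> 0"
          using Y Yx unfolding tendsto_at_iff_sequentially q_def by (force simp: o_def)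
        then show "(\<lambda>k. q k w) \<longlonglongrightarrow> 0"
          by (simp add: tendsto_norm_zero_iff tendsto_rabs_zero_iff)
      qed
      show "AE w in M. norm (q k w) \<le> 2 * B w" for k
      proof (rule AE_I2)
        fix w assume w: "w \<in> space M"
        have "\<bar>g (Y k) w - g x w - G w (Y k - x)\<bar> \<le> 2 * B w * norm (Y k - x)"
          using lip[OF Y(1)[of k] w] bd[OF w, of "Y k - x"] by linarith
        then show "norm (q k w) \<le> 2 * B w"
          using Y(2)[of k] by (simp add: q_def abs_divide pos_divide_le_eq)
      qed
    qed (use B in auto)
    then have "(\<lambda>k. norm (\<integral>w. q k w \<partial>M)) \<longlonglongrightarrow> 0"
      by (simp add: tendsto_rabs_zero_iff)
    moreover have "(\<integral>w. q k w \<partial>M)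
        = ((\<integral>w. g (Y k) w \<partial>M) - (\<integral>w. g x w \<partial>M) - (\<integral>w. G w (Y k - x) \<partial>M)) / norm (Y k - x)" for k
      using int[OF Y(1)[of k]] int[OF U(2)] intG by (simp add: q_def)
    ultimately have "(\<lambda>k. norm ((\<integral>w. g (X (k + N)) w \<partial>M) - (\<integral>w. g x w \<partial>M) - (\<integral>w. G w (X (k + N) - x) \<partial>M))
        / norm (X (k + N) - x)) \<longlonglongrightarrow> 0"
      by (simp add: Y_def abs_divide)
    then show "((\<lambda>u. norm ((\<integral>w. g u w \<partial>M) - (\<integral>w. g x w \<partial>M) - (\<integral>w. G w (u - x) \<partial>M)) / norm (u - x)) \<circ> X)
        \<longlonglongrightarrow> 0"
      unfolding o_def by (rule LIMSEQ_offset)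
  qed
  ultimately show ?thesis
    by (simp add: has_derivative_iff_norm)
qed

text \<open>Summable real families are absolutely summable, hence integrable for the counting
  measure; this carries differentiation under the integral over to sums.\<close>

lemma infsum_eq_integral_count_space:
  fixes f :: "'a \<Rightarrow> real"
  assumes "f summable_on A"
  shows "integrable (count_space A) f" "infsum f A = (\<integral>x. f x \<partial>count_space A)"
proof -
  have "Infinite_Set_Sum.abs_summable_on f A"
    using assms unfolding abs_summable_equivalent[symmetric]
    by (simp only: summable_on_iff_abs_summable_on_real[symmetric])
  then show "integrable (count_space A) f" "infsum f A = (\<integral>x. f x \<partial>count_space A)"
    by (simp_all add: abs_summable_on_def infsetsum_infsum[symmetric] infsetsum_def)
qed

lemma has_derivative_infsum_dominated:
  fixes g :: "'a::real_normed_vector \<Rightarrow> 'b \<Rightarrow> real"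
  assumes U: "open U" "x \<in> U"
    and sum: "\<And>u. u \<in> U \<Longrightarrow> g u summable_on A"
    and der: "\<And>w. w \<in> A \<Longrightarrow> ((\<lambda>u. g u w) has_derivative G w) (at x)"
    and B: "B summable_on A"
    and lip: "\<And>u w. u \<in> U \<Longrightarrow> w \<in> A \<Longrightarrow> \<bar>g u w - g x w\<bar> \<le> B w * norm (u - x)"
  shows "((\<lambda>u. \<Sum>\<^sub>\<infinity>w\<in>A. g u w) has_derivative (\<lambda>h. \<Sum>\<^sub>\<infinity>w\<in>A. G w h)) (at x)"
proof -
  have bd: "\<bar>G w h\<bar> \<le> B w * norm h" if "w \<in> A" for w h
    by (rule has_derivative_norm_le[OF der[OF that] U]) (use lip that in auto)
  have "(\<lambda>w. G w h) summable_on A" for h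
    by (rule abs_summable_summable, rule summable_on_comparison_test[of "\<lambda>w. B w * norm h"])
       (use bd B in \<open>auto intro!: summable_on_cmult_left\<close>)
  then have G: "(\<lambda>h. \<Sum>\<^sub>\<infinity>w\<in>A. G w h) = (\<lambda>h. \<integral>w. G w h \<partial>count_space A)"
    by (simp add: infsum_eq_integral_count_space)
  have "((\<lambda>u. \<integral>w. g u w \<partial>count_space A) has_derivative (\<lambda>h. \<integral>w. G w h \<partial>count_space A)) (at x)"
  proof (rule has_derivative_integral_dominated[OF U])
    show "\<bar>g u w - g x w\<bar> \<le> B w * norm (u - x)" if "u \<in> U" "w \<in> space (count_space A)" for u w
      using lip that by simp
  qed (use sum der B infsum_eq_integral_count_space(1) in auto)
  then have "((\<lambda>u. \<Sum>\<^sub>\<infinity>w\<in>A. g u w) has_derivative (\<lambda>h. \<integral>w. G w h \<partial>count_space A)) (at x)"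
    by (rule has_derivative_transform_within_open[OF _ U])
       (use sum in \<open>simp add: infsum_eq_integral_count_space\<close>)
  then show ?thesis
    by (simp add: G)
qed

section \<open>Laplace transforms of measures\<close>

text \<open>The mean value bound \<open>t * exp (- (r0 * t))\<close> is weakened to a multiple of a
  pure exponential, so that integrating it against a representing measure gives a value of the
  Laplace transform again.\<close>

lemma exp_decay_lipschitz:
  fixes r0 u r t :: real
  assumes "0 < r0" "r0 \<le> u" "r0 \<le> r" "0 \<le> t"
  shows "\<bar>exp (- (u * t)) - exp (- (r * t))\<bar> \<le> 2 / r0 * exp (- (r0 / 2 * t)) * \<bar>u - r\<bar>"
  using assms(2,3)
proof (induction u r rule: linorder_wlog)
  case (le u r)
  have "exp (- (u * t)) - exp (- (r * t)) = exp (- (u * t)) * (1 - exp (- ((r - u) * t)))"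
    by (simp add: algebra_simps flip: exp_add)
  also have "\<dots> \<le> exp (- (r0 * t)) * ((r - u) * t)"
  proof (rule mult_mono)
    show "exp (- (u * t)) \<le> exp (- (r0 * t))"
      using le assms by (simp add: mult_right_mono)
    show "1 - exp (- ((r - u) * t)) \<le> (r - u) * t"
      using exp_ge_add_one_self[of "- ((r - u) * t)"] by linarith
    show "0 \<le> 1 - exp (- ((r - u) * t))"
      using le assms by (simp add: mult_nonneg_nonneg)
  qed simp
  also \<comment> \<open>half of the exponential decay absorbs the factor \<open>t\<close>\<close>
  have "\<dots> \<le> exp (- (r0 * t)) * ((r - u) * (2 / r0 * exp (r0 / 2 * t)))"
  proof -
    have "r0 / 2 * t \<le> exp (r0 / 2 * t)"
      using exp_ge_add_one_self[of "r0 / 2 * t"] by linarith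
    then have "t \<le> 2 / r0 * exp (r0 / 2 * t)"
      using \<open>0 < r0\<close> by (simp add: field_simps)
    then show ?thesis
      using le by (intro mult_left_mono) auto
  qed
  also have "\<dots> = 2 / r0 * (exp (- (r0 * t)) * exp (r0 / 2 * t)) * (r - u)"
    by (simp add: algebra_simps)
  also have "exp (- (r0 * t)) * exp (r0 / 2 * t) = exp (- (r0 / 2 * t))"
    by (simp flip: exp_add)
  finally have "exp (- (u * t)) - exp (- (r * t)) \<le> 2 / r0 * exp (- (r0 / 2 * t)) * (r - u)" .
  moreover have "exp (- (r * t)) \<le> exp (- (u * t))"
    using le assms by (simp add: mult_right_mono)
  ultimately show ?case
    using le by (simp add: abs_if)
next
  case (sym u r)
  then show ?case
    by (simp add: abs_minus_commute)
qed

text \<open>The integral representation from \<open>potentials_S\<close> without the decay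
  condition, with the measure as a parameter so that it can be fixed across lemmas.\<close>

definition laplace_rep :: "real measure \<Rightarrow> (real \<Rightarrow> real) \<Rightarrow> bool" where
  "laplace_rep \<mu> f \<longleftrightarrow> sets \<mu> = sets (restrict_space borel {0<..}) \<and>
     (\<forall>r>0. has_bochner_integral \<mu> (\<lambda>t. exp (- (r * t))) (f r))"

context
  fixes \<mu> :: "real measure" and f :: "real \<Rightarrow> real"
  assumes rep: "laplace_rep \<mu> f"
begin

lemma laplace_rep_space: "space \<mu> = {0<..}"
  using rep sets_eq_imp_space_eq[of \<mu> "restrict_space borel {0<..}"]
  by (simp add: laplace_rep_def space_restrict_space)

lemma laplace_rep_integrable: "0 < r \<Longrightarrow> integrable \<mu> (\<lambda>t. exp (- (r * t)))"
  and laplace_rep_eq: "0 < r \<Longrightarrow> f r = (\<integral>t. exp (- (r * t)) \<partial>\<mu>)"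
  using rep by (auto simp: laplace_rep_def has_bochner_integral_iff)

lemma laplace_rep_nonneg: "0 < r \<Longrightarrow> 0 \<le> f r"
  by (simp add: laplace_rep_eq)

lemma laplace_rep_antimono: "f r' \<le> f r" if "0 < r" "r \<le> r'"
  using that laplace_rep_integrable unfolding laplace_rep_eq[OF that(1)] laplace_rep_eq[OF less_le_trans[OF that]]
  by (intro integral_mono) (auto simp: laplace_rep_space)

text \<open>Integrates \<open>exp_decay_lipschitz\<close> over \<open>\<mu>\<close>. As the constant
  contains a value of \<open>f\<close>, decay of \<open>f\<close> passes to its increments, with an
  extra factor \<open>1 / r0\<close>.\<close>

lemma laplace_rep_lipschitz:
  assumes "0 < r0" "r0 \<le> u" "r0 \<le> r"
  shows "\<bar>f u - f r\<bar> \<le> 2 / r0 * f (r0 / 2) * \<bar>u - r\<bar>"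
proof -
  have pos: "0 < u" "0 < r" "0 < r0 / 2"
    using assms by auto
  have "f u - f r = (\<integral>t. exp (- (u * t)) - exp (- (r * t)) \<partial>\<mu>)"
    using laplace_rep_integrable pos by (simp add: laplace_rep_eq)
  also have "norm \<dots> \<le> (\<integral>t. 2 / r0 * exp (- (r0 / 2 * t)) * \<bar>u - r\<bar> \<partial>\<mu>)"
  proof (rule Bochner_Integration.integral_norm_bound_integral)
    show "integrable \<mu> (\<lambda>t. 2 / r0 * exp (- (r0 / 2 * t)) * \<bar>u - r\<bar>)"
      using laplace_rep_integrable[OF pos(3)] by simp
    show "norm (exp (- (u * t)) - exp (- (r * t))) \<le> 2 / r0 * exp (- (r0 / 2 * t)) * \<bar>u - r\<bar>"
      if "t \<in> space \<mu>" for t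
      using exp_decay_lipschitz[OF assms] that by (simp add: laplace_rep_space)
  qed (use laplace_rep_integrable pos in auto)
  also have "\<dots> = 2 / r0 * f (r0 / 2) * \<bar>u - r\<bar>"
    by (simp add: laplace_rep_eq[OF pos(3)])
  finally show ?thesis
    by simp
qed

lemma laplace_rep_differentiable:
  assumes r: "0 < r"
  shows "f differentiable (at r)"
proof -
  have "((\<lambda>u. \<integral>t. exp (- (u * t)) \<partial>\<mu>) has_derivative (\<lambda>h. \<integral>t. - (h * t) * exp (- (r * t)) \<partial>\<mu>)) (at r)"
  \<comment> \<open>On \<open>U\<close> all arguments exceed \<open>r / 2\<close>, so the dominating
    exponential has rate \<open>r / 4\<close>, which is positive and therefore integrable.\<close>
  proof (rule has_derivative_integral_dominated[where U = "{r/2<..}"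
          and B = "\<lambda>t. 2 / (r/2) * exp (- (r/2 / 2 * t))"])
    have "(\<lambda>t. t) \<in> borel_measurable \<mu>"
      using rep measurable_restrict_space1[OF measurable_ident[of borel, unfolded id_def], of "{0<..}"]
        measurable_cong_sets[of \<mu> "restrict_space borel {0<..}" borel borel]
      unfolding laplace_rep_def by blast
    then show "(\<lambda>t. - (h * t) * exp (- (r * t))) \<in> borel_measurable \<mu>" for h
      by measurable
    show "integrable \<mu> (\<lambda>t. 2 / (r/2) * exp (- (r/2 / 2 * t)))"
      using laplace_rep_integrable[of "r/2/2"] r by simp
    show "\<bar>exp (- (u * t)) - exp (- (r * t))\<bar> \<le> 2 / (r/2) * exp (- (r/2 / 2 * t)) * norm (u - r)"
      if "u \<in> {r/2<..}" "t \<in> space \<mu>" for u t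
      using exp_decay_lipschitz[of "r/2" u r t] that r by (simp add: laplace_rep_space)
    show "((\<lambda>u. exp (- (u * t))) has_derivative (\<lambda>h. - (h * t) * exp (- (r * t)))) (at r)" for t
      by (auto intro!: derivative_eq_intros)
  qed (use r laplace_rep_integrable in auto)
  then have "(f has_derivative (\<lambda>h. \<integral>t. - (h * t) * exp (- (r * t)) \<partial>\<mu>)) (at r)"
    by (rule has_derivative_transform_within_open[where s = "{0<..}"])
       (use r laplace_rep_eq in auto)
  then show ?thesis
    by (rule differentiableI)
qed

text \<open>The asymptotic bound holds beyond some \<open>R\<close>. Between \<open>\<delta>\<close>
  and \<open>R\<close> monotonicity gives \<open>f r \<le> f \<delta>\<close>, while
  \<open>R powr s * r powr (- s)\<close> is at least 1; the constant adds the contributions of both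
  ranges.\<close>

lemma laplace_rep_decay:
  assumes "f \<in> O[at_top](\<lambda>r. r powr (- s))" "0 \<le> s" "0 < \<delta>"
  obtains C where "0 \<le> C" "\<And>r. \<delta> \<le> r \<Longrightarrow> f r \<le> C * r powr (- s)"
proof -
  obtain c where "c > 0" and c: "\<forall>\<^sub>F r in at_top. norm (f r) \<le> c * norm (r powr (- s))"
    using assms(1) by (elim landau_o.bigE)
  then obtain R0 where R0: "\<And>r. R0 \<le> r \<Longrightarrow> norm (f r) \<le> c * norm (r powr (- s))"
    by (auto simp: eventually_at_top_linorder)
  define R where "R = max R0 \<delta>"
  have "R > 0" "f \<delta> \<ge> 0"
    using assms laplace_rep_nonneg by (auto simp: R_def)
  show ?thesis
  proof (rule that[of "c + f \<delta> * R powr s"])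
    show "0 \<le> c + f \<delta> * R powr s"
      using \<open>c > 0\<close> \<open>f \<delta> \<ge> 0\<close> by simp
    fix r assume r: "\<delta> \<le> r"
    show "f r \<le> (c + f \<delta> * R powr s) * r powr (- s)"
    proof (cases "R \<le> r")
      case True
      then have "f r \<le> c * r powr (- s)"
        using R0[of r] by (simp add: R_def)
      also have "\<dots> \<le> (c + f \<delta> * R powr s) * r powr (- s)"
        using \<open>f \<delta> \<ge> 0\<close> by (intro mult_right_mono) auto
      finally show ?thesis .
    next
      case False
      have "r powr s * r powr (- s) = 1"
        using r assms by (simp flip: powr_add)
      moreover have "r powr s \<le> R powr s"
        using False r assms by (intro powr_mono2) auto
      ultimately have "1 \<le> R powr s * r powr (- s)"
        by (metis mult_right_mono powr_ge_zero)
      then have "f \<delta> * 1 \<le> f \<delta> * (R powr s * r powr (- s))"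
        using \<open>f \<delta> \<ge> 0\<close> by (rule mult_left_mono)
      moreover have "f r \<le> f \<delta>"
        using r assms laplace_rep_antimono by auto
      moreover have "0 \<le> c * r powr (- s)"
        using \<open>c > 0\<close> by simp
      ultimately show ?thesis
        unfolding distrib_right mult.assoc by linarith
    qed
  qed
qed

end


section \<open>Lattice sums\<close>

definition int_vec :: "('n::finite \<Rightarrow> int) \<Rightarrow> real^'n" where
  "int_vec m = (\<chi> i. of_int (m i))"

lemma int_vec_nth [simp]: "int_vec m $ i = of_int (m i)"
  by (simp add: int_vec_def)

lemma int_vec_eq_0_iff [simp]: "int_vec m = 0 \<longleftrightarrow> m = (\<lambda>_. 0)"
  by (auto simp: vec_eq_iff)

lemma int_vec_zero [simp]: "int_vec (\<lambda>_. 0) = 0"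
  by simp

lemma norm_int_vec_ge_1:
  assumes "m \<noteq> (\<lambda>_. 0)"
  shows "1 \<le> norm (int_vec m)"
proof -
  obtain i where "m i \<noteq> 0"
    using assms by auto
  then have "1 \<le> \<bar>int_vec m $ i\<bar>"
    by simp
  also have "\<dots> \<le> norm (int_vec m)"
    by (rule component_le_norm_cart)
  finally show ?thesis .
qed

text \<open>Triangle inequality followed by Cauchy-Schwarz; \<open>norm v\<close> is the Frobenius
  norm of the matrix.\<close>

lemma norm_lattice_point_le: "norm (lattice_point v m) \<le> norm (int_vec m) * norm v"
proof -
  have "norm (lattice_point v m) \<le> (\<Sum>i\<in>UNIV. norm (of_int (m i) *\<^sub>R (v $ i)))"
    unfolding lattice_point_def by (rule norm_sum)
  also have "\<dots> = (\<Sum>i\<in>UNIV. \<bar>norm (int_vec m $ i)\<bar> * \<bar>norm (v $ i)\<bar>)"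
    by simp
  also have "\<dots> \<le> norm (int_vec m) * norm v"
    unfolding norm_vec_def by (rule L2_set_mult_ineq)
  finally show ?thesis .
qed

lemma linear_lattice_point: "linear (\<lambda>u. lattice_point u m)"
  by (rule linearI) (simp_all add: lattice_point_def algebra_simps sum.distrib scaleR_sum_right)

lemma lattice_point_minus: "lattice_point u (\<lambda>i. m i - m' i) = lattice_point u m - lattice_point u m'"
  by (simp add: lattice_point_def algebra_simps sum_subtractf)

lemma lattice_point_zero [simp]: "lattice_point u (\<lambda>_. 0) = 0"
  by (simp add: lattice_point_def)

lemma summable_on_int_powr:
  assumes "1 < p"
  shows "(\<lambda>k::int. (1 + \<bar>real_of_int k\<bar>) powr (- p)) summable_on UNIV"
proof -
  let ?f = "\<lambda>k::int. (1 + \<bar>real_of_int k\<bar>) powr (- p)"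
  have "summable (\<lambda>n. real n powr (- p))"
    using assms by (simp add: summable_real_powr_iff)
  then have "summable (\<lambda>n. real (n + k) powr (- p))" for k
    by (rule summable_ignore_initial_segment)
  then have nat: "(\<lambda>n. real (n + k) powr (- p)) summable_on UNIV" for k
    by (simp add: summable_on_UNIV_nonneg_real_iff)
  \<comment> \<open>The index \<open>int n\<close> contributes
    \<open>real (n + 1) powr (- p)\<close> and \<open>- int (Suc n)\<close> contributes
    \<open>real (n + 2) powr (- p)\<close>, hence the shifts 1 and 2.\<close>
  have "?f summable_on range int"
    using nat[of 1] by (subst summable_on_reindex) (auto simp: o_def add.commute)
  moreover have "?f summable_on range (\<lambda>n. - int (Suc n))"
    using nat[of 2] by (subst summable_on_reindex) (auto simp: o_def inj_on_def add.commute)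
  moreover have "range int \<inter> range (\<lambda>n. - int (Suc n)) = {}"
    by auto
  ultimately have "?f summable_on (range int \<union> range (\<lambda>n. - int (Suc n)))"
    by (rule summable_on_Un_disjoint)
  also have "range int \<union> range (\<lambda>n. - int (Suc n)) = UNIV"
  proof -
    have "k \<in> range int \<union> range (\<lambda>n. - int (Suc n))" for k
      by (cases k rule: int_cases) blast+
    then show ?thesis
      by blast
  qed
  finally show ?thesis .
qed

text \<open>Since \<open>1 + \<bar>m i\<bar> \<le> 2 * norm (int_vec m)\<close> for every \<open>i\<close>, the sum is dominated by a product of
  convergent one-dimensional series, so no lattice points have to be counted.\<close>

lemma summable_on_norm_int_vec_powr:
  assumes "real CARD('n::finite) / 2 < s"
  shows "(\<lambda>m::'n \<Rightarrow> int. norm (int_vec m) powr (- (2 * s))) summable_on (UNIV - {\<lambda>_. 0})"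
proof -
  \<comment> \<open>The exponent \<open>2 * s\<close> is shared equally among the coordinates;
    \<open>1 < p\<close> is the assumption on \<open>s\<close> rewritten.\<close>
  define p where "p = 2 * s / real CARD('n)"
  have p: "1 < p" "p * real CARD('n) = 2 * s"
    using assms by (auto simp: p_def field_simps)
  let ?q = "\<lambda>m::'n \<Rightarrow> int. \<Prod>i\<in>UNIV. (1 + \<bar>real_of_int (m i)\<bar>) powr (- p)"
  have "Infinite_Set_Sum.abs_summable_on (\<lambda>k. (1 + \<bar>real_of_int k\<bar>) powr (- p)) UNIV"
    using summable_on_int_powr[OF p(1)] by (simp flip: abs_summable_equivalent)
  then have "Infinite_Set_Sum.abs_summable_on ?q (PiE UNIV (\<lambda>_. UNIV))"
    by (intro abs_summable_on_prod_PiE) auto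
  then have "?q summable_on UNIV"
    by (simp add: abs_prod flip: abs_summable_equivalent)
  then have "?q summable_on (UNIV - {\<lambda>_. 0})"
    by (rule summable_on_subset_banach) auto
  \<comment> \<open>The factor \<open>2 powr (2 * s)\<close> pays for the 2 in
    \<open>1 + \<bar>m i\<bar> \<le> 2 * norm (int_vec m)\<close>.\<close>
  then have sum: "(\<lambda>m. 2 powr (2 * s) * ?q m) summable_on (UNIV - {\<lambda>_. 0})"
    by (rule summable_on_cmult_right)
  show ?thesis
  proof (rule summable_on_comparison_test[OF sum])
    fix m :: "'n \<Rightarrow> int" assume "m \<in> UNIV - {\<lambda>_. 0}"
    then have N: "1 \<le> norm (int_vec m)"
      by (intro norm_int_vec_ge_1) auto
    have "(2 * norm (int_vec m)) powr (- (2 * s)) = ((2 * norm (int_vec m)) powr (- p)) ^ CARD('n)"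
      using p(2) N by (subst powr_realpow[symmetric]) (auto simp: powr_powr)
    also have "\<dots> = (\<Prod>i\<in>(UNIV::'n set). (2 * norm (int_vec m)) powr (- p))"
      by simp
    also have "\<dots> \<le> ?q m"
    proof (intro prod_mono conjI)
      fix i :: 'n
      have "\<bar>real_of_int (m i)\<bar> \<le> norm (int_vec m)"
        using component_le_norm_cart[of "int_vec m" i] by simp
      then show "(2 * norm (int_vec m)) powr (- p) \<le> (1 + \<bar>real_of_int (m i)\<bar>) powr (- p)"
        using p(1) N by (intro powr_mono2') auto
    qed simp
    finally have "2 powr (2 * s) * (2 * norm (int_vec m)) powr (- (2 * s)) \<le> 2 powr (2 * s) * ?q m"
      by (rule mult_left_mono) simp
    moreover have "2 powr (2 * s) * (2 * norm (int_vec m)) powr (- (2 * s)) = norm (int_vec m) powr (- (2 * s))"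
      by (simp add: powr_mult mult.assoc[symmetric] flip: powr_add)
    ultimately show "norm (int_vec m) powr (- (2 * s)) \<le> 2 powr (2 * s) * ?q m"
      by simp
  qed simp
qed

section \<open>Uniform estimates for bases near a given one\<close>

context
  fixes x :: "real^'n::finite^'n" and c :: real
  assumes c: "0 < c" and low: "\<And>m. c * norm (int_vec m) \<le> norm (lattice_point x m)"
begin

text \<open>Passing from \<open>x\<close> to \<open>u\<close> moves the point with coordinates
  \<open>m\<close> by at most \<open>c / 2 * norm (int_vec m)\<close>, half of its lower bound at
  \<open>x\<close>.\<close>

lemma norm_lattice_point_ge:
  assumes "u \<in> ball x (c / 2)"
  shows "c / 2 * norm (int_vec m) \<le> norm (lattice_point u m)"
proof -
  have "lattice_point u m = lattice_point x m - lattice_point (x - u) m"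
    using linear_diff[OF linear_lattice_point[of m], of x u] by simp
  then have "norm (lattice_point x m) \<le> norm (lattice_point u m) + norm (lattice_point (x - u) m)"
    by (metis diff_add_cancel norm_triangle_ineq)
  moreover have "norm (lattice_point (x - u) m) \<le> norm (int_vec m) * (c / 2)"
    using norm_lattice_point_le[of "x - u" m] assms
    by (intro order_trans[OF norm_lattice_point_le] mult_left_mono) (auto simp: dist_norm)
  ultimately show ?thesis
    using low[of m] by (simp add: algebra_simps)
qed

lemma norm_lattice_point_sq_ge:
  assumes "u \<in> ball x (c / 2)"
  shows "c\<^sup>2 / 4 * (norm (int_vec m))\<^sup>2 \<le> (norm (lattice_point u m))\<^sup>2"
proof -
  have "(c / 2 * norm (int_vec m))\<^sup>2 \<le> (norm (lattice_point u m))\<^sup>2"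
    using norm_lattice_point_ge[OF assms] c by (intro power_mono) auto
  then show ?thesis
    by (simp add: power_mult_distrib power_divide)
qed

text \<open>The difference of two coordinate tuples of one point represents 0, and the lower bound
  then makes it zero. This makes parity, and so the charge, well defined near
  \<open>x\<close>.\<close>

lemma inj_lattice_point:
  assumes "u \<in> ball x (c / 2)"
  shows "inj (lattice_point u)"
proof (rule injI)
  fix m m' assume "lattice_point u m = lattice_point u m'"
  then have "c / 2 * norm (int_vec (\<lambda>i. m i - m' i)) \<le> 0"
    using norm_lattice_point_ge[OF assms, of "\<lambda>i. m i - m' i"] by (simp add: lattice_point_minus)
  then have "norm (int_vec (\<lambda>i. m i - m' i)) \<le> 0"
    using c by (simp add: mult_le_0_iff)
  then show "m = m'"
    by (simp add: fun_eq_iff)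
qed

lemma alt_charge_lattice_point:
  assumes "u \<in> ball x (c / 2)"
  shows "alt_charge u (lattice_point u m) = (if even (\<Sum>i\<in>UNIV. m i) then 1 else - 1)"
  using inj_lattice_point[OF assms] by (auto simp: alt_charge_def inj_eq)

text \<open>Integer coordinates make the index set independent of \<open>u\<close>, as termwise
  differentiation in \<open>u\<close> requires.\<close>

lemma infsum_lattice:
  fixes F :: "real^'n \<Rightarrow> real"
  assumes "u \<in> ball x (c / 2)"
  shows "(\<Sum>\<^sub>\<infinity>p\<in>lattice_of u - {0}. F p) = (\<Sum>\<^sub>\<infinity>m\<in>UNIV - {\<lambda>_. 0}. F (lattice_point u m))"
proof -
  have inj: "inj (lattice_point u)"
    by (rule inj_lattice_point[OF assms])
  then have "lattice_of u - {0} = lattice_point u ` (UNIV - {\<lambda>_. 0})"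
    unfolding lattice_of_def by (subst image_set_diff) auto
  then show ?thesis
    using infsum_reindex[OF inj_on_subset[OF inj subset_UNIV], of F "UNIV - {\<lambda>_. 0}"] by (simp add: o_def)
qed

section \<open>Convergence and termwise differentiation of weighted lattice sums\<close>

context
  fixes f f' :: "real \<Rightarrow> real" and w :: "('n \<Rightarrow> int) \<Rightarrow> real"
  assumes f: "f \<in> potentials_S CARD('n)"
    and w: "\<And>m. \<bar>w m\<bar> \<le> 1"
begin

text \<open>The range of \<open>k\<close> covers two uses: convergence takes
  \<open>k = c\<^sup>2 / 4\<close>, from the lower bound on squared norms, and the Lipschitz
  estimate takes \<open>k = c\<^sup>2 / 8\<close>, because \<open>laplace_rep_lipschitz\<close>
  evaluates \<open>f\<close> at \<open>r0 / 2\<close>.\<close>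

lemma potential_bounds:
  obtains s \<mu> C where "real CARD('n) / 2 < s" "laplace_rep \<mu> f" "0 \<le> C"
    "\<forall>(m :: 'n \<Rightarrow> int) k. m \<noteq> (\<lambda>_. 0) \<longrightarrow> c\<^sup>2 / 8 \<le> k \<longrightarrow>
       f (k * (norm (int_vec m))\<^sup>2) \<le> C * (k powr (- s) * norm (int_vec m) powr (- (2 * s)))"
proof -
  obtain \<mu> s where \<mu>: "laplace_rep \<mu> f" and s: "real CARD('n) / 2 < s" "f \<in> O[at_top](\<lambda>r. r powr (- s))"
    using f by (auto simp: potentials_S_def laplace_rep_def)
  have "0 \<le> s" "0 < c\<^sup>2 / 8"
    using s(1) c by (auto intro: order_trans[OF _ less_imp_le[OF s(1)]])
  then obtain C where C: "0 \<le> C" "\<And>r. c\<^sup>2 / 8 \<le> r \<Longrightarrow> f r \<le> C * r powr (- s)"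
    using laplace_rep_decay[OF \<mu> s(2)] by blast
  show ?thesis
  proof (rule that[OF s(1) \<mu> C(1)], intro allI impI)
    fix m :: "'n \<Rightarrow> int" and k :: real
    assume "m \<noteq> (\<lambda>_. 0)" and k: "c\<^sup>2 / 8 \<le> k"
    then have N: "1 \<le> norm (int_vec m)"
      by (intro norm_int_vec_ge_1)
    have "0 < k"
      using k \<open>0 < c\<^sup>2 / 8\<close> by linarith
    have "1 \<le> (norm (int_vec m))\<^sup>2"
      using N by (rule one_le_power)
    then have "c\<^sup>2 / 8 \<le> k * (norm (int_vec m))\<^sup>2"
      using k \<open>0 < k\<close> mult_left_mono[of 1 "(norm (int_vec m))\<^sup>2" k] by linarith
    then have "f (k * (norm (int_vec m))\<^sup>2) \<le> C * (k * (norm (int_vec m))\<^sup>2) powr (- s)"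
      by (rule C(2))
    also have "(k * (norm (int_vec m))\<^sup>2) powr (- s) = k powr (- s) * norm (int_vec m) powr (- (2 * s))"
      using \<open>0 < k\<close> N by (simp add: powr_mult powr_powr flip: powr_numeral)
    finally show "f (k * (norm (int_vec m))\<^sup>2) \<le> C * (k powr (- s) * norm (int_vec m) powr (- (2 * s)))" .
  qed
qed

text \<open>Since \<open>f\<close> decreases, its value at a squared norm is at most its value at
  the lower bound for that squared norm, where the decay applies.\<close>

lemma summable_on_lattice_sum:
  assumes u: "u \<in> ball x (c / 2)"
  shows "(\<lambda>m. w m * f ((norm (lattice_point u m))\<^sup>2)) summable_on (UNIV - {\<lambda>_. 0})"
proof -
  obtain s \<mu> C where s: "real CARD('n) / 2 < s" and \<mu>: "laplace_rep \<mu> f" and "0 \<le> C"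
    and bd: "\<forall>(m :: 'n \<Rightarrow> int) k. m \<noteq> (\<lambda>_. 0) \<longrightarrow> c\<^sup>2 / 8 \<le> k \<longrightarrow>
       f (k * (norm (int_vec m))\<^sup>2) \<le> C * (k powr (- s) * norm (int_vec m) powr (- (2 * s)))"
    by (rule potential_bounds)
  have "(\<lambda>m::'n \<Rightarrow> int. C * ((c\<^sup>2 / 4) powr (- s) * norm (int_vec m) powr (- (2 * s)))) summable_on (UNIV - {\<lambda>_. 0})"
    by (intro summable_on_cmult_right summable_on_norm_int_vec_powr s)
  then have "(\<lambda>m. norm (w m * f ((norm (lattice_point u m))\<^sup>2))) summable_on (UNIV - {\<lambda>_. 0})"
  proof (rule summable_on_comparison_test)
    fix m :: "'n \<Rightarrow> int" assume "m \<in> UNIV - {\<lambda>_. 0}"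
    then have m: "m \<noteq> (\<lambda>_. 0)"
      by simp
    define r0 where "r0 = c\<^sup>2 / 4 * (norm (int_vec m))\<^sup>2"
    have r0: "0 < r0" "r0 \<le> (norm (lattice_point u m))\<^sup>2"
      using norm_lattice_point_sq_ge[OF u, of m] c m unfolding r0_def by auto
    have "norm (w m * f ((norm (lattice_point u m))\<^sup>2)) \<le> 1 * f ((norm (lattice_point u m))\<^sup>2)"
    unfolding norm_mult
      using w[of m] laplace_rep_nonneg[OF \<mu> less_le_trans[OF r0]]
      by (intro mult_mono) simp_all
    also have "\<dots> \<le> f r0"
      using laplace_rep_antimono[OF \<mu> r0] by simp
    also have "\<dots> \<le> C * ((c\<^sup>2 / 4) powr (- s) * norm (int_vec m) powr (- (2 * s)))"
      unfolding r0_def by (rule bd[rule_format, OF m]) simp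
    finally show "norm (w m * f ((norm (lattice_point u m))\<^sup>2))
        \<le> C * ((c\<^sup>2 / 4) powr (- s) * norm (int_vec m) powr (- (2 * s)))" .
  qed simp
  then show ?thesis
    by (rule abs_summable_summable)
qed

text \<open>A change of basis alters the squared norm by at most a multiple of
  \<open>(norm (int_vec m))\<^sup>2 * norm (u - x)\<close>. The factor \<open>1 / r0\<close> in the
  Lipschitz constant of \<open>f\<close> cancels this square, leaving the summable
  \<open>norm (int_vec m) powr (- (2 * s))\<close>.\<close>

lemma has_derivative_lattice_sum:
  assumes f': "\<And>r. 0 < r \<Longrightarrow> (f has_real_derivative f' r) (at r)"
  shows "((\<lambda>u. \<Sum>\<^sub>\<infinity>m\<in>UNIV - {\<lambda>_. 0}. w m * f ((norm (lattice_point u m))\<^sup>2)) has_derivative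
    (\<lambda>v. \<Sum>\<^sub>\<infinity>m\<in>UNIV - {\<lambda>_. 0}.
       w m * (2 * (lattice_point x m \<bullet> lattice_point v m) * f' ((norm (lattice_point x m))\<^sup>2)))) (at x)"
proof -
  obtain s \<mu> C where s: "real CARD('n) / 2 < s" and \<mu>: "laplace_rep \<mu> f" and "0 \<le> C"
    and bd: "\<forall>(m :: 'n \<Rightarrow> int) k. m \<noteq> (\<lambda>_. 0) \<longrightarrow> c\<^sup>2 / 8 \<le> k \<longrightarrow>
       f (k * (norm (int_vec m))\<^sup>2) \<le> C * (k powr (- s) * norm (int_vec m) powr (- (2 * s)))"
    by (rule potential_bounds)
  \<comment> \<open>The factors come from \<open>2 / r0 * (N * N)\<close>, from the decay of
    \<open>f\<close> at \<open>r0 / 2\<close>, and from the bound on \<open>norm u + norm x\<close>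
    over the ball.\<close>
  define K where "K = 8 / c\<^sup>2 * (C * (c\<^sup>2 / 8) powr (- s)) * (2 * norm x + c / 2)"
  show ?thesis
  proof (rule has_derivative_infsum_dominated[where U = "ball x (c / 2)"
        and B = "\<lambda>m. K * norm (int_vec m) powr (- (2 * s))"])
    show "(\<lambda>m::'n \<Rightarrow> int. K * norm (int_vec m) powr (- (2 * s))) summable_on (UNIV - {\<lambda>_. 0})"
      by (intro summable_on_cmult_right summable_on_norm_int_vec_powr s)
  next
    fix m :: "'n \<Rightarrow> int" assume "m \<in> UNIV - {\<lambda>_. 0}"
    then have N: "1 \<le> norm (int_vec m)"
      by (intro norm_int_vec_ge_1) auto
    have P: "((\<lambda>u. lattice_point u m) has_derivative (\<lambda>v. lattice_point v m)) (at x)"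
      by (rule linear_imp_has_derivative[OF linear_lattice_point])
    have "0 < c * norm (int_vec m)"
      using c N by (intro mult_pos_pos) linarith+
    then have "0 < norm (lattice_point x m)"
      using low[of m] by linarith
    then have "(f has_real_derivative f' ((norm (lattice_point x m))\<^sup>2)) (at (lattice_point x m \<bullet> lattice_point x m))"
      using f' by (simp add: power2_norm_eq_inner)
    then have "((\<lambda>u. f (lattice_point u m \<bullet> lattice_point u m)) has_derivative
        (\<lambda>v. (lattice_point x m \<bullet> lattice_point v m + lattice_point v m \<bullet> lattice_point x m) *
          f' ((norm (lattice_point x m))\<^sup>2))) (at x)"
      by (rule DERIV_compose_FDERIV) (rule has_derivative_inner[OF P P])
    then have "((\<lambda>u. w m * f (lattice_point u m \<bullet> lattice_point u m)) has_derivative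
        (\<lambda>v. w m * ((lattice_point x m \<bullet> lattice_point v m + lattice_point v m \<bullet> lattice_point x m) *
          f' ((norm (lattice_point x m))\<^sup>2)))) (at x)"
      by (rule has_derivative_mult_right)
    then show "((\<lambda>u. w m * f ((norm (lattice_point u m))\<^sup>2)) has_derivative
        (\<lambda>v. w m * (2 * (lattice_point x m \<bullet> lattice_point v m) * f' ((norm (lattice_point x m))\<^sup>2)))) (at x)"
      by (simp add: power2_norm_eq_inner inner_commute)
  next
    fix u and m :: "'n \<Rightarrow> int" assume u: "u \<in> ball x (c / 2)" and "m \<in> UNIV - {\<lambda>_. 0}"
    then have m: "m \<noteq> (\<lambda>_. 0)"
      by simp
    define N where "N = norm (int_vec m)"
    have N: "1 \<le> N"
      unfolding N_def by (rule norm_int_vec_ge_1[OF m])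
    define r0 where "r0 = c\<^sup>2 / 4 * N\<^sup>2"
    have r0: "0 < r0" "r0 \<le> (norm (lattice_point u m))\<^sup>2" "r0 \<le> (norm (lattice_point x m))\<^sup>2"
      using norm_lattice_point_sq_ge[OF u, of m] norm_lattice_point_sq_ge[of x m] c N
      by (auto simp: r0_def simp flip: N_def)
    have diff: "\<bar>(norm (lattice_point u m))\<^sup>2 - (norm (lattice_point x m))\<^sup>2\<bar>
        \<le> (N * norm (u - x)) * (N * (2 * norm x + c / 2))"
    proof -
      have "\<bar>norm (lattice_point u m) - norm (lattice_point x m)\<bar> \<le> norm (lattice_point (u - x) m)"
        using norm_triangle_ineq3[of "lattice_point u m" "lattice_point x m"]
        by (simp add: linear_diff[OF linear_lattice_point[of m]])
      also have "\<dots> \<le> N * norm (u - x)"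
        unfolding N_def by (rule norm_lattice_point_le)
      finally have 1: "\<bar>norm (lattice_point u m) - norm (lattice_point x m)\<bar> \<le> N * norm (u - x)" .
      have "norm u \<le> norm x + c / 2"
        using u norm_triangle_sub[of u x] by (simp add: dist_norm norm_minus_commute)
      then have "N * norm u + N * norm x \<le> N * (2 * norm x + c / 2)"
        using N mult_left_mono[of "norm u + norm x" "2 * norm x + c / 2" N] by (simp add: distrib_left)
      then have 2: "norm (lattice_point u m) + norm (lattice_point x m) \<le> N * (2 * norm x + c / 2)"
        using norm_lattice_point_le[of u m] norm_lattice_point_le[of x m] by (simp add: N_def)
      have "\<bar>(norm (lattice_point u m))\<^sup>2 - (norm (lattice_point x m))\<^sup>2\<bar>
        = \<bar>norm (lattice_point u m) - norm (lattice_point x m)\<bar> * (norm (lattice_point u m) + norm (lattice_point x m))"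
        unfolding power2_eq_square square_diff_square_factored abs_mult
        by (subst mult.commute) simp
      also have "\<dots> \<le> (N * norm (u - x)) * (N * (2 * norm x + c / 2))"
        using 1 2 N by (intro mult_mono) auto
      finally show ?thesis .
    qed
    have half: "f (r0 / 2) \<le> C * ((c\<^sup>2 / 8) powr (- s) * N powr (- (2 * s)))"
      using bd[rule_format, OF m, of "c\<^sup>2 / 8"] by (simp add: r0_def N_def)
    have "\<bar>w m * f ((norm (lattice_point u m))\<^sup>2) - w m * f ((norm (lattice_point x m))\<^sup>2)\<bar>
        = \<bar>w m\<bar> * \<bar>f ((norm (lattice_point u m))\<^sup>2) - f ((norm (lattice_point x m))\<^sup>2)\<bar>"
      by (simp add: abs_mult flip: right_diff_distrib)
    also have "\<dots> \<le> 1 * (2 / r0 * f (r0 / 2) * \<bar>(norm (lattice_point u m))\<^sup>2 - (norm (lattice_point x m))\<^sup>2\<bar>)"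
      by (rule mult_mono[OF w laplace_rep_lipschitz[OF \<mu> r0]]) auto
    also have "\<dots> \<le> 1 * (2 / r0 * (C * ((c\<^sup>2 / 8) powr (- s) * N powr (- (2 * s)))) *
        ((N * norm (u - x)) * (N * (2 * norm x + c / 2))))"
      using r0(1) \<open>0 \<le> C\<close> by (intro mult_left_mono mult_mono half diff) auto
    also have "\<dots> = 2 / r0 * (N * N) * (C * (c\<^sup>2 / 8) powr (- s)) *
        (2 * norm x + c / 2) * N powr (- (2 * s)) * norm (u - x)"
      by (simp only: mult_1 mult.assoc mult.commute mult.left_commute)
    also have "2 / r0 * (N * N) = 8 / c\<^sup>2"
      using N c by (simp add: r0_def power2_eq_square)
    also have "8 / c\<^sup>2 * (C * (c\<^sup>2 / 8) powr (- s)) * (2 * norm x + c / 2) * N powr (- (2 * s)) * norm (u - x)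
        = K * N powr (- (2 * s)) * norm (u - x)"
      by (simp only: K_def)
    finally show "\<bar>w m * f ((norm (lattice_point u m))\<^sup>2) - w m * f ((norm (lattice_point x m))\<^sup>2)\<bar>
        \<le> K * norm (int_vec m) powr (- (2 * s)) * norm (u - x)"
      by (simp only: N_def)
  next
    show "open (ball x (c / 2))" "x \<in> ball x (c / 2)"
      using c by simp_all
    show "(\<lambda>m. w m * f ((norm (lattice_point u m))\<^sup>2)) summable_on (UNIV - {\<lambda>_. 0})"
      if "u \<in> ball x (c / 2)" for u
      using that by (rule summable_on_lattice_sum)
  qed
qed

end

end


section \<open>Symmetries of the cubic lattice\<close>

lemma lattice_point_cubic_basis:
  "lattice_point (cubic_basis V) m = V powr (1 / real CARD('n)) *\<^sub>R (int_vec m :: real^'n::finite)"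
  by (simp add: lattice_point_def cubic_basis_def vec_eq_iff axis_def if_distrib[of "\<lambda>y. _ * y"] cong: if_cong)

lemma norm_lattice_point_cubic_basis_ge:
  "V powr (1 / real CARD('n)) * norm (int_vec m) \<le> norm (lattice_point (cubic_basis V :: real^'n::finite^'n) m)"
  by (simp add: lattice_point_cubic_basis)

text \<open>Treats signed permutations of the coordinates in one statement: \<open>p = id\<close>
  gives sign changes, and \<open>m' = m \<circ> p\<close> gives permutations.\<close>

lemma norm_int_vec_cong:
  assumes "bij p" and "\<And>i. \<bar>m' i\<bar> = \<bar>m (p i)\<bar>"
  shows "norm (int_vec m') = norm (int_vec (m :: 'n::finite \<Rightarrow> int))"
proof -
  have "int_vec m' \<bullet> int_vec m' = (\<Sum>i\<in>UNIV. (of_int \<bar>m (p i)\<bar>)\<^sup>2)"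
    by (simp add: inner_vec_def power2_eq_square flip: assms(2))
  also have "\<dots> = (\<Sum>i\<in>UNIV. (of_int \<bar>m i\<bar>)\<^sup>2)"
    using assms(1) by (rule sum.reindex_bij_betw)
  also have "\<dots> = int_vec m \<bullet> int_vec m"
    by (simp add: inner_vec_def power2_eq_square)
  finally show ?thesis
    by (simp add: norm_eq_sqrt_inner)
qed

text \<open>Here \<open>axis i (axis j 1)\<close> is the matrix unit with its single 1 in row
  \<open>i\<close> and column \<open>j\<close>.\<close>

lemma matrix_expansion:
  "v = (\<Sum>i\<in>UNIV. \<Sum>j\<in>UNIV. v $ i $ j *\<^sub>R axis i (axis j (1::real)))" for v :: "real^'n::finite^'m::finite"
proof -
  have "(\<Sum>i\<in>UNIV. \<Sum>j\<in>UNIV. v $ i $ j *\<^sub>R axis i (axis j 1)) $ k $ l = v $ k $ l" for k l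
  proof -
    have "(\<Sum>i\<in>UNIV. \<Sum>j\<in>UNIV. v $ i $ j *\<^sub>R axis i (axis j 1)) $ k $ l
        = (\<Sum>i\<in>UNIV. \<Sum>j\<in>UNIV. if k = i then (if l = j then v $ i $ j else 0) else 0)"
      by (auto simp: axis_def intro!: sum.cong)
    also have "\<dots> = (\<Sum>i\<in>UNIV. if k = i then \<Sum>j\<in>UNIV. (if l = j then v $ i $ j else 0) else 0)"
      by (intro sum.cong) auto
    also have "\<dots> = v $ k $ l"
      by simp
    finally show ?thesis .
  qed
  then show ?thesis
    by (simp add: vec_eq_iff)
qed

lemma linear_eq_trace:
  fixes D :: "real^'n::finite^'n \<Rightarrow> real"
  assumes D: "linear D"
    and off: "\<And>i j. i \<noteq> j \<Longrightarrow> D (axis i (axis j 1)) = 0"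
    and diag: "\<And>i j. D (axis i (axis i 1)) = D (axis j (axis j 1))"
  shows "\<exists>K. \<forall>v. D v = K * trace v"
proof -
  \<comment> \<open>An arbitrary index; the factor \<open>K\<close> is the common value of
    \<open>D\<close> on the diagonal matrix units, read off at \<open>k\<close>.\<close>
  obtain k :: 'n where True by simp
  show ?thesis
  proof (intro exI allI)
    fix v
    have "D v = (\<Sum>i\<in>UNIV. \<Sum>j\<in>UNIV. v $ i $ j * D (axis i (axis j 1)))"
      by (subst matrix_expansion[of v]) (simp add: linear_sum[OF D] linear_scale[OF D])
    also have "\<dots> = (\<Sum>i\<in>UNIV. \<Sum>j\<in>UNIV. if i = j then v $ i $ i * D (axis k (axis k 1)) else 0)"
      using off diag[of _ k] by (intro sum.cong) auto
    also have "\<dots> = D (axis k (axis k 1)) * trace v"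
      by (simp add: trace_def sum_distrib_left mult.commute)
    finally show "D v = D (axis k (axis k 1)) * trace v" .
  qed
qed

lemma neq_zero_fun_iff: "f \<in> UNIV - {\<lambda>_. 0} \<longleftrightarrow> (\<exists>k. f k \<noteq> 0)"
  by auto

text \<open>Reflecting coordinate \<open>i\<close> permutes the index set and negates every term, so
  the sum equals its own negative. This is also consistent with the default value 0 of
  \<open>infsum\<close> on non-summable families.\<close>

lemma infsum_off_diagonal:
  fixes c :: "('n \<Rightarrow> int) \<Rightarrow> real"
  assumes "i \<noteq> j" and c: "\<And>m. c (m(i := - m i)) = c m"
  shows "(\<Sum>\<^sub>\<infinity>m\<in>UNIV - {\<lambda>_. 0}. c m * of_int (m i) * of_int (m j)) = 0"
proof -
  let ?r = "\<lambda>m::'n \<Rightarrow> int. m(i := - m i)"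
  have "(\<Sum>\<^sub>\<infinity>m\<in>UNIV - {\<lambda>_. 0}. c m * of_int (m i) * of_int (m j))
      = (\<Sum>\<^sub>\<infinity>m\<in>UNIV - {\<lambda>_. 0}. - (c m * of_int (m i) * of_int (m j)))"
  proof (rule infsum_reindex_bij_witness[where i = ?r and j = ?r])
    show "?r m \<in> UNIV - {\<lambda>_. 0}" if m: "m \<in> UNIV - {\<lambda>_. 0}" for m
    proof -
      obtain k where "m k \<noteq> 0"
        using m unfolding neq_zero_fun_iff by blast
      then have "?r m k \<noteq> 0"
        by auto
      then show ?thesis
        unfolding neq_zero_fun_iff by blast
    qed
    then show "?r m \<in> UNIV - {\<lambda>_. 0}" if "m \<in> UNIV - {\<lambda>_. 0}" for m
      using that .
  qed (use \<open>i \<noteq> j\<close> c in auto)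
  then show ?thesis
    by (simp add: infsum_uminus)
qed

text \<open>Swapping the two coordinates is an involution of the index set that carries one sum to
  the other.\<close>

lemma infsum_diagonal_eq:
  fixes c :: "('n \<Rightarrow> int) \<Rightarrow> real"
  assumes c: "\<And>m. c (m \<circ> Transposition.transpose i j) = c m"
  shows "(\<Sum>\<^sub>\<infinity>m\<in>UNIV - {\<lambda>_. 0}. c m * of_int (m i) * of_int (m i))
    = (\<Sum>\<^sub>\<infinity>m\<in>UNIV - {\<lambda>_. 0}. c m * of_int (m j) * of_int (m j))"
proof -
  let ?r = "\<lambda>m::'n \<Rightarrow> int. m \<circ> Transposition.transpose i j"
  have inv: "?r (?r m) = m" for m
    by (simp add: fun_eq_iff)
  show ?thesis
  proof (rule infsum_reindex_bij_witness[where i = ?r and j = ?r])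
    show "?r m \<in> UNIV - {\<lambda>_. 0}" if m: "m \<in> UNIV - {\<lambda>_. 0}" for m
    proof -
      obtain k where "m k \<noteq> 0"
        using m unfolding neq_zero_fun_iff by blast
      then have "?r m (Transposition.transpose i j k) \<noteq> 0"
        by simp
      then show ?thesis
        unfolding neq_zero_fun_iff by blast
    qed
    then show "?r m \<in> UNIV - {\<lambda>_. 0}" if "m \<in> UNIV - {\<lambda>_. 0}" for m
      using that .
    show "?r (?r m) = m" for m
      by (rule inv)
    then show "?r (?r m) = m" for m .
    show "c (?r m) * of_int (?r m j) * of_int (?r m j) = c m * of_int (m i) * of_int (m i)" for m
      by (simp add: c)
  qed
qed

text \<open>The weight \<open>w\<close> is the constant charge or the alternating charge.\<close>

context
  fixes w :: "('n::finite \<Rightarrow> int) \<Rightarrow> real" and V :: real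
  assumes w: "\<And>m. \<bar>w m\<bar> \<le> 1"
    and w_flip: "\<And>m i. w (m(i := - m i)) = w m"
    and w_perm: "\<And>m p. bij p \<Longrightarrow> w (m \<circ> p) = w m"
    and V: "0 < V"
begin

lemma has_derivative_cubic_S:
  assumes f: "f \<in> potentials_S CARD('n)"
  obtains K where "((\<lambda>u. \<Sum>\<^sub>\<infinity>m\<in>UNIV - {\<lambda>_. 0}. w m * f ((norm (lattice_point u m))\<^sup>2)) has_derivative
    (\<lambda>v. K * trace v)) (at (cubic_basis V :: real^'n^'n))"
proof -
  let ?x = "cubic_basis V :: real^'n^'n" and ?a = "V powr (1 / real CARD('n))"
  have a: "0 < ?a"
    using V by simp
  obtain \<mu> where \<mu>: "laplace_rep \<mu> f"
    using f by (auto simp: potentials_S_def laplace_rep_def)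
  have "(f has_real_derivative deriv f r) (at r)" if "0 < r" for r
    using laplace_rep_differentiable[OF \<mu> that] by (simp add: DERIV_deriv_iff_real_differentiable)
  note der = has_derivative_lattice_sum[where w = w, OF a norm_lattice_point_cubic_basis_ge f w this]
  \<comment> \<open>For \<open>v\<close> the matrix unit at \<open>i\<close>, \<open>j\<close>, the
    inner product in the derivative is \<open>?a * m i * m j\<close>. The remaining factors form
    \<open>c m\<close>, which depends on \<open>m\<close> only through \<open>w m\<close> and the
    norm.\<close>
  define c where "c = (\<lambda>m. 2 * ?a * w m * deriv f ((norm (lattice_point ?x m))\<^sup>2))"
  define D where "D = (\<lambda>v. \<Sum>\<^sub>\<infinity>m\<in>UNIV - {\<lambda>_. 0}.
       w m * (2 * (lattice_point ?x m \<bullet> lattice_point v m) * deriv f ((norm (lattice_point ?x m))\<^sup>2)))"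
  have c_flip: "c (m(i := - m i)) = c m" for m i
    using norm_int_vec_cong[of id "m(i := - m i)" m] by (simp add: c_def w_flip lattice_point_cubic_basis)
  have c_perm: "c (m \<circ> p) = c m" if "bij p" for m p
    using norm_int_vec_cong[OF that, of "m \<circ> p" m] that by (simp add: c_def w_perm lattice_point_cubic_basis)
  have D_axis: "D (axis i (axis j 1)) = (\<Sum>\<^sub>\<infinity>m\<in>UNIV - {\<lambda>_. 0}. c m * of_int (m i) * of_int (m j))" for i j
  proof -
    have "lattice_point (axis i (axis j 1)) m = of_int (m i) *\<^sub>R axis j (1::real)" for m
    proof -
      have "lattice_point (axis i (axis j 1)) m = (\<Sum>k\<in>UNIV. if k = i then of_int (m i) *\<^sub>R axis j (1::real) else 0)"
        unfolding lattice_point_def by (intro sum.cong) (auto simp: axis_def)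
      then show ?thesis
        by simp
    qed
    then show ?thesis
      unfolding D_def by (intro infsum_cong) (simp add: c_def lattice_point_cubic_basis inner_axis mult_ac)
  qed
  have "linear D"
    using has_derivative_linear[OF der] unfolding D_def .
  then have "\<exists>K. \<forall>v. D v = K * trace v"
  proof (rule linear_eq_trace)
    show "D (axis i (axis j 1)) = 0" if "i \<noteq> j" for i j
      unfolding D_axis using that c_flip by (rule infsum_off_diagonal)
    show "D (axis i (axis i 1)) = D (axis j (axis j 1))" for i j
      unfolding D_axis by (rule infsum_diagonal_eq, rule c_perm) simp
  qed
  then obtain K where "D = (\<lambda>v. K * trace v)"
    by auto
  then show ?thesis
    using der that unfolding D_def by simp
qed

lemma has_derivative_cubic_F:
  assumes f: "f \<in> potentials_F CARD('n)"
  obtains K where "((\<lambda>u. \<Sum>\<^sub>\<infinity>m\<in>UNIV - {\<lambda>_. 0}. w m * f ((norm (lattice_point u m))\<^sup>2)) has_derivative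
    (\<lambda>v. K * trace v)) (at (cubic_basis V :: real^'n^'n))"
proof -
  let ?x = "cubic_basis V :: real^'n^'n" and ?a = "V powr (1 / real CARD('n))"
  have a: "0 < ?a"
    using V by simp
  obtain g h where g: "g \<in> potentials_S CARD('n)" and h: "h \<in> potentials_S CARD('n)"
    and fgh: "\<And>r. 0 < r \<Longrightarrow> f r = g r - h r"
    using f by (auto simp: potentials_F_def)
  obtain Kg where
    Kg: "((\<lambda>u. \<Sum>\<^sub>\<infinity>m\<in>UNIV - {\<lambda>_. 0}. w m * g ((norm (lattice_point u m))\<^sup>2)) has_derivative
      (\<lambda>v. Kg * trace v)) (at ?x)"
    by (rule has_derivative_cubic_S[OF g])
  obtain Kh where
    Kh: "((\<lambda>u. \<Sum>\<^sub>\<infinity>m\<in>UNIV - {\<lambda>_. 0}. w m * h ((norm (lattice_point u m))\<^sup>2)) has_derivative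
      (\<lambda>v. Kh * trace v)) (at ?x)"
    by (rule has_derivative_cubic_S[OF h])
  have "((\<lambda>u. \<Sum>\<^sub>\<infinity>m\<in>UNIV - {\<lambda>_. 0}. w m * f ((norm (lattice_point u m))\<^sup>2)) has_derivative
      (\<lambda>v. Kg * trace v - Kh * trace v)) (at ?x)"
  proof (rule has_derivative_transform_within_open[OF has_derivative_diff[OF Kg Kh]])
    show "open (ball ?x (?a / 2))" "?x \<in> ball ?x (?a / 2)"
      using a by simp_all
    fix u assume u: "u \<in> ball ?x (?a / 2)"
    note sum = summable_on_lattice_sum[OF a norm_lattice_point_cubic_basis_ge _ w u]
    have "(\<Sum>\<^sub>\<infinity>m\<in>UNIV - {\<lambda>_. 0}. w m * g ((norm (lattice_point u m))\<^sup>2))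
        - (\<Sum>\<^sub>\<infinity>m\<in>UNIV - {\<lambda>_. 0}. w m * h ((norm (lattice_point u m))\<^sup>2))
      = (\<Sum>\<^sub>\<infinity>m\<in>UNIV - {\<lambda>_. 0}. w m * g ((norm (lattice_point u m))\<^sup>2) - w m * h ((norm (lattice_point u m))\<^sup>2))"
      using infsum_add[OF sum[OF g] summable_on_uminus[THEN iffD2, OF sum[OF h]]]
      by (simp add: infsum_uminus)
    also have "\<dots> = (\<Sum>\<^sub>\<infinity>m\<in>UNIV - {\<lambda>_. 0}. w m * f ((norm (lattice_point u m))\<^sup>2))"
    proof (rule infsum_cong)
      fix m :: "'n \<Rightarrow> int" assume "m \<in> UNIV - {\<lambda>_. 0}"
      \<comment> \<open>The identity \<open>f r = g r - h r\<close> is available for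
        \<open>r > 0\<close>; injectivity shows that the lattice point is nonzero.\<close>
      then have "lattice_point u m \<noteq> lattice_point u (\<lambda>_. 0)"
        using inj_lattice_point[OF a norm_lattice_point_cubic_basis_ge u] by (auto simp: inj_eq simp del: lattice_point_zero)
      then show "w m * g ((norm (lattice_point u m))\<^sup>2) - w m * h ((norm (lattice_point u m))\<^sup>2)
          = w m * f ((norm (lattice_point u m))\<^sup>2)"
        by (simp add: fgh right_diff_distrib)
    qed
    finally show "(\<Sum>\<^sub>\<infinity>m\<in>UNIV - {\<lambda>_. 0}. w m * g ((norm (lattice_point u m))\<^sup>2))
        - (\<Sum>\<^sub>\<infinity>m\<in>UNIV - {\<lambda>_. 0}. w m * h ((norm (lattice_point u m))\<^sup>2))
      = (\<Sum>\<^sub>\<infinity>m\<in>UNIV - {\<lambda>_. 0}. w m * f ((norm (lattice_point u m))\<^sup>2))" .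
  qed
  then show ?thesis
    using that[of "Kg - Kh"] by (simp add: left_diff_distrib)
qed

end

section \<open>The hypersurface of fixed volume\<close>

lemma det_cubic_basis: "det (cubic_basis V :: real^'n::finite^'n) = V" if "0 < V"
proof -
  have "det (cubic_basis V :: real^'n^'n) = (\<Prod>i\<in>(UNIV::'n set). V powr (1 / real CARD('n)))"
    by (subst det_diagonal) (auto simp: cubic_basis_def axis_def)
  also have "\<dots> = V"
    using that by (simp add: powr_realpow[symmetric] powr_powr)
  finally show ?thesis .
qed

text \<open>The product rule applied to each term of the Leibniz expansion.\<close>

lemma has_derivative_det:
  fixes x :: "real^'n::finite^'n"
  shows "(det has_derivative (\<lambda>v. \<Sum>p | p permutes UNIV.
    of_int (sign p) * (\<Sum>i\<in>UNIV. v $ i $ p i * (\<Prod>j\<in>UNIV - {i}. x $ j $ p j)))) (at x)"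
proof -
  have nth: "((\<lambda>u. u $ i $ j) has_derivative (\<lambda>v. v $ i $ j)) (at x)" for i j
    by (rule bounded_linear_imp_has_derivative)
       (intro bounded_linear_compose[OF bounded_linear_vec_nth bounded_linear_vec_nth])
  show ?thesis
    unfolding det_def[abs_def]
    by (intro has_derivative_sum has_derivative_mult_right has_derivative_prod nth)
qed

text \<open>Jacobi's formula at a scalar matrix. A permutation other than the identity moves at
  least two indices, so an off-diagonal zero remains even after one factor is
  differentiated.\<close>

lemma has_derivative_det_cubic_basis:
  fixes V :: real
  defines "a \<equiv> V powr (1 / real CARD('n::finite))"
  shows "(det has_derivative (\<lambda>v. a ^ (CARD('n) - 1) * trace v)) (at (cubic_basis V :: real^'n^'n))"
proof -
  let ?x = "cubic_basis V :: real^'n^'n"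
  have x: "?x $ j $ k = (if j = k then a else 0)" for j k
    by (auto simp: cubic_basis_def axis_def a_def)
  have "(\<Sum>p | p permutes UNIV. of_int (sign p) * (\<Sum>i\<in>UNIV. v $ i $ p i * (\<Prod>j\<in>UNIV - {i}. ?x $ j $ p j)))
      = a ^ (CARD('n) - 1) * trace v" (is "sum ?t _ = _") for v :: "real^'n^'n"
  proof -
    have "sum ?t {p. p permutes UNIV} = sum ?t {id}"
    proof (rule sum.mono_neutral_right)
      show "\<forall>p\<in>{p. p permutes (UNIV :: 'n set)} - {id}. ?t p = 0"
      proof
        fix p assume "p \<in> {p. p permutes (UNIV :: 'n set)} - {id}"
        then have p: "inj p" and "p \<noteq> id"
          by (auto simp: permutes_inj)
        then obtain k where k: "p k \<noteq> k"
          by (auto simp: fun_eq_iff)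
        have 0: "(\<Prod>j\<in>UNIV - {i}. ?x $ j $ p j) = 0" for i
        proof -
          \<comment> \<open>If the omitted index \<open>i\<close> is the moved index
            \<open>k\<close>, then \<open>p k\<close> is another moved index, by injectivity of
            \<open>p\<close>.\<close>
          have "\<exists>j\<in>UNIV - {i}. p j \<noteq> j"
          proof (cases "k = i")
            case True
            then show ?thesis
              using k injD[OF p, of "p k" k] by (intro bexI[of _ "p k"]) auto
          qed (use k in auto)
          then obtain j where j: "j \<in> UNIV - {i}" "p j \<noteq> j"
            by blast
          then have "?x $ j $ p j = 0"
            by (simp add: x eq_commute)
          with j(1) show ?thesis
            by (intro prod_zero) auto
        qed
        show "?t p = 0"
          by (simp only: 0 mult_zero_right sum.neutral_const)
      qed
    qed (auto simp: permutes_id finite_permutations)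
    also have "\<dots> = a ^ (CARD('n) - 1) * trace v"
      by (simp add: x sign_id trace_def card_Diff_singleton sum_distrib_left mult.commute)
    finally show ?thesis .
  qed
  then show ?thesis
    using has_derivative_det[of ?x] by simp
qed

lemma trace_tangent_vector_cubic_basis:
  fixes v :: "real^'n::finite^'n"
  assumes V: "0 < V" and v: "v \<in> tangent_vectors (bases_of_volume V) (cubic_basis V)"
  shows "trace v = 0"
proof -
  let ?a = "V powr (1 / real CARD('n))"
  obtain \<gamma> where \<gamma>: "\<gamma> 0 = cubic_basis V" "\<forall>\<^sub>F t in nhds 0. \<gamma> t \<in> bases_of_volume V"
    "(\<gamma> has_vector_derivative v) (at (0::real))"
    using v by (auto simp: tangent_vectors_def)
  have "((\<lambda>t. det (\<gamma> t)) has_derivative (\<lambda>t. ?a ^ (CARD('n) - 1) * trace (t *\<^sub>R v))) (at 0)"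
    using \<gamma>(3) unfolding has_vector_derivative_def
    by (rule has_derivative_compose) (unfold \<gamma>(1), rule has_derivative_det_cubic_basis)
  then have "((\<lambda>t. det (\<gamma> t)) has_real_derivative ?a ^ (CARD('n) - 1) * trace v) (at 0)"
    by (rule has_derivative_imp_has_field_derivative) (simp add: trace_def sum_distrib_left mult_ac)
  \<comment> \<open>The constraint fixes the absolute value of the determinant; squaring removes the
    sign and gives a function that is constant near 0.\<close>
  then have "((\<lambda>t. (det (\<gamma> t))\<^sup>2) has_real_derivative 2 * (det (\<gamma> 0) * (?a ^ (CARD('n) - 1) * trace v))) (at 0)"
    by (auto intro!: derivative_eq_intros)
  moreover have "\<forall>\<^sub>F t in nhds 0. (det (\<gamma> t))\<^sup>2 = V\<^sup>2"
    using \<gamma>(2) by eventually_elim (auto simp: bases_of_volume_def)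
  then have "((\<lambda>t. (det (\<gamma> t))\<^sup>2) has_real_derivative 0) (at 0)"
    by (subst DERIV_cong_ev[OF refl _ refl]) auto
  ultimately have "2 * (det (\<gamma> 0) * (?a ^ (CARD('n) - 1) * trace v)) = 0"
    by (rule DERIV_unique)
  then show ?thesis
    using V by (simp add: \<gamma>(1) det_cubic_basis)
qed

theorem theorem2p1:
  fixes f1 f2 :: "real \<Rightarrow> real" and V :: real
  assumes "f1 \<in> potentials_F CARD('n::finite)"
    and "f2 \<in> potentials_F CARD('n)"
    and "V > 0"
  shows "critical_point_on (bases_of_volume V) (alt_energy f1 f2) (cubic_basis V :: real^'n^'n)"
proof -
  let ?x = "cubic_basis V :: real^'n^'n" and ?a = "V powr (1 / real CARD('n))"
  let ?e = "\<lambda>m :: 'n \<Rightarrow> int. if even (\<Sum>i\<in>UNIV. m i) then 1 else - 1 :: real"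
  have a: "0 < ?a"
    using \<open>V > 0\<close> by simp
  obtain K1 where K1: "((\<lambda>u. \<Sum>\<^sub>\<infinity>m\<in>UNIV - {\<lambda>_. 0}. 1 * f1 ((norm (lattice_point u m))\<^sup>2)) has_derivative
      (\<lambda>v. K1 * trace v)) (at ?x)"
    by (rule has_derivative_cubic_F[of "\<lambda>_. 1" V f1]) (use assms in auto)
  have flip: "even (\<Sum>k\<in>UNIV. (m(i := - m i)) k) = even (\<Sum>k\<in>UNIV. m k)" for m :: "'n \<Rightarrow> int" and i
  proof -
    have "(\<Sum>k\<in>UNIV. (m(i := - m i)) k) = (\<Sum>k\<in>UNIV. m k) - 2 * m i"
      by (simp add: sum.remove[of UNIV i])
    then show ?thesis
      by simp
  qed
  have perm: "(\<Sum>k\<in>UNIV. (m \<circ> p) k) = (\<Sum>k\<in>UNIV. m k)" if "bij p" for m :: "'n \<Rightarrow> int" and p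
    using sum.reindex_bij_betw[OF that, of m] by simp
  have e_flip: "?e (m(i := - m i)) = ?e m" for m i
    by (simp only: flip)
  have e_perm: "?e (m \<circ> p) = ?e m" if "bij p" for m p
    by (simp only: perm[OF that])
  obtain K2 where K2: "((\<lambda>u. \<Sum>\<^sub>\<infinity>m\<in>UNIV - {\<lambda>_. 0}. ?e m * f2 ((norm (lattice_point u m))\<^sup>2)) has_derivative
      (\<lambda>v. K2 * trace v)) (at ?x)"
    by (rule has_derivative_cubic_F[of ?e V f2, OF _ e_flip e_perm \<open>V > 0\<close> assms(2)]) auto
  \<comment> \<open>The energy agrees with the two coordinate sums on a ball where coordinates are
    unique. This gives its derivative on the whole matrix space, which is then restricted to the
    hypersurface.\<close>
  have "(alt_energy f1 f2 has_derivative (\<lambda>v. K1 * trace v + K2 * trace v)) (at ?x)"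
  proof (rule has_derivative_transform_within_open[OF has_derivative_add[OF K1 K2]])
    show "open (ball ?x (?a / 2))" "?x \<in> ball ?x (?a / 2)"
      using a by auto
    show "(\<Sum>\<^sub>\<infinity>m\<in>UNIV - {\<lambda>_. 0}. 1 * f1 ((norm (lattice_point u m))\<^sup>2)) +
        (\<Sum>\<^sub>\<infinity>m\<in>UNIV - {\<lambda>_. 0}. ?e m * f2 ((norm (lattice_point u m))\<^sup>2)) = alt_energy f1 f2 u"
      if u: "u \<in> ball ?x (?a / 2)" for u
      by (simp add: alt_energy_def infsum_lattice[OF a norm_lattice_point_cubic_basis_ge u] alt_charge_lattice_point[OF a norm_lattice_point_cubic_basis_ge u])
  qed
  then have "(alt_energy f1 f2 has_derivative (\<lambda>v. K1 * trace v + K2 * trace v)) (at ?x within bases_of_volume V)"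
    by (rule has_derivative_at_withinI)
  moreover have "?x \<in> bases_of_volume V"
    using \<open>V > 0\<close> by (simp add: bases_of_volume_def det_cubic_basis)
  ultimately show ?thesis
    using trace_tangent_vector_cubic_basis[OF \<open>V > 0\<close>] unfolding critical_point_on_def by fastforce
qed

end
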